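(* Let $G$ be a finite $p$-subgroup of $\mathrm{Aut}(k[[t]])$, with associated HKG-cover as in the context, let $m$ be the first pole number at $P$ not divisible by $p$ (so $m=\bar m_s$), and let $\bar C_s\in H^1\big(G,k_{\mathbf n,m}[\bar f_0,\bar f_1,\dots,\bar f_{s-1}]\big)$ be the cocycle $\bar C_s(\sigma)=\sigma(\bar f_s)-\bar f_s$ corresponding to $m$. Choose as uniformizer the canonical uniformizer $t=\bar f_s^{-1/m}$. Define $$\Phi:G\longrightarrow\mathrm{Aut}(k[[t]]),\qquad \sigma\longmapsto\Big(t\mapsto t\big(1+\bar C_s(\sigma)t^m\big)^{-1/m}\Big).$$ The expression $(1+\bar C_s(\sigma)t^m)^{-1/m}$ can be expanded as a power series using the binomial theorem and determines uniquely an automorphism of $k[[t]]$. For all $\sigma,\tau\in G$, $$\Phi(\tau\sigma)=\Phi(\sigma)\Phi(\tau).$$ Furthermore, $\Phi$ is injective (a monomorphism).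
   Context: $k$ is an algebraically closed field of characteristic $p\ge5$. An HKG-cover (with $p$-group) is a Galois cover $X\to\mathbb P^1$ over $k$ with Galois group a finite $p$-group and with a unique ramified point $P\in X$, which is totally and wildly ramified. A finite $p$-subgroup $G\subset\mathrm{Aut}(k[[t]])$ is associated with an HKG-cover $X\to\mathbb P^1$ with group $G$ such that the (left) $G$-action on $\hat{\mathcal O}_{X,P}\cong k[[t]]$ is the given one; thus $F=k(X)\subset k((t))$. The pole numbers at $P$ are $0=m_0<m_1<\cdots$ and $m=m_r$ is the first one not divisible by $p$. Let $\rho_i:G\to\mathrm{GL}(L(m_iP))$, $0\le i\le r$ ($\rho_r$ is faithful), and let $c_1<\dots<c_s$ be the indices with $\ker\rho_{c_i}\supsetneq\ker\rho_{c_i+1}$. Set $F_i=F^{\ker\rho_{c_i}}$ ($1\le i\le s$), $F_{s+1}=F$, $\bar m_i=m_{c_i+1}$, and let $\bar f_i$ be a function with polar divisor $\bar m_iP$, so that $F_{i+1}=F_i(\bar f_i)$; $\bar f_0$ is a generator of $F_1=F^G=k(\bar f_0)$ with pole only at $P$, of order $\bar m_0=|G|$. One has $\bar m_s=m$. Each $\mathrm{Gal}(F_{i+1}/F_i)\cong(\mathbb Z/p\mathbb Z)^{n_i}$, and $k_{\mathbf n,m}[\bar f_0,\dots,\bar f_{s-1}]$ is the $k$-span of monomials $\bar f_0^{a_0}\cdots\bar f_{s-1}^{a_{s-1}}$ with $a_0\ge0$, $0\le a_j<p^{n_j}$ for $j\ge1$ and $\sum_\nu a_\nu\bar m_\nu<m$;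 it equals the $G$-module $L((m-1)P)$. Its elements are regarded as Laurent series in $t$, so $\bar C_s(\sigma)t^m\in tk[[t]]$. The canonical uniformizer $t=\bar f_s^{-1/m}$ is a uniformizer at $P$ with $t^{-m}=\bar f_s$. In the identity $\Phi(\tau\sigma)=\Phi(\sigma)\Phi(\tau)$, elements of $\mathrm{Aut}(k[[t]])$ are identified with power series (images of $t$) and the product is composition (substitution) of power series, $(\alpha\beta)(t)=\alpha(\beta(t))$. *)

theory Defs
  imports
    "HOL-Algebra.Group"
    "HOL-Computational_Algebra.Computational_Algebra"
    "HOL-Library.Infinite_Set"
begin

section \<open>Automorphisms of the power series ring\<close>

definition fps_Aut :: "('k::field fps \<Rightarrow> 'k fps) monoid" where
  "fps_Aut = \<lparr> carrier = {\<phi>. bij \<phi> \<and> (\<forall>f g. \<phi> (f + g) = \<phi> f + \<phi> g) \<and>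
       (\<forall>f g. \<phi> (f * g) = \<phi> f * \<phi> g) \<and> (\<forall>a. \<phi> (fps_const a) = fps_const a)},
     monoid.mult = (\<circ>), one = id \<rparr>"

text \<open>The extension of an automorphism of the power series ring to its fraction field:
  with \<open>X\<close> the given coordinate, \<open>f = X\<^sup>n u\<close> with \<open>u\<close> a unit power series is sent to
  \<open>\<sigma>(X)\<^sup>n \<sigma>(u)\<close>.\<close>

definition fls_act :: "('k::field fps \<Rightarrow> 'k fps) \<Rightarrow> 'k fls \<Rightarrow> 'k fls" where
  "fls_act \<sigma> f =
     fps_to_fls (\<sigma> fps_X) powi fls_subdegree f * fps_to_fls (\<sigma> (fls_base_factor_to_fps f))"

section \<open>Function fields inside the field of Laurent series\<close>

definition k_subfield :: "'k::field fls set \<Rightarrow> bool" where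
  "k_subfield K \<longleftrightarrow> range fls_const \<subseteq> K \<and>
     (\<forall>f\<in>K. \<forall>g\<in>K. f + g \<in> K \<and> f * g \<in> K) \<and> (\<forall>f\<in>K. - f \<in> K \<and> inverse f \<in> K)"

text \<open>The field \<open>k(S)\<close>.\<close>

definition k_adjoin :: "'k::field fls set \<Rightarrow> 'k fls set" where
  "k_adjoin S = \<Inter>{K. k_subfield K \<and> S \<subseteq> K}"

definition k_transcendental :: "'k::field fls \<Rightarrow> bool" where
  "k_transcendental x \<longleftrightarrow> (\<forall>q::'k poly. q \<noteq> 0 \<longrightarrow> poly (map_poly fls_const q) x \<noteq> 0)"

text \<open>The points of the curve with function field \<open>F\<close> are the places of \<open>F\<close> over \<open>k\<close>, given by
  their valuation rings; \<open>P\<close> is the place induced by the Laurent series valuation.\<close>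

definition is_place :: "'k::field fls set \<Rightarrow> 'k fls set \<Rightarrow> bool" where
  "is_place F V \<longleftrightarrow> range fls_const \<subseteq> V \<and> V \<subset> F \<and>
     (\<forall>f\<in>V. \<forall>g\<in>V. f + g \<in> V \<and> f * g \<in> V) \<and> (\<forall>f\<in>V. - f \<in> V) \<and>
     (\<forall>f\<in>F. f \<in> V \<or> inverse f \<in> V)"

definition place_P :: "'k::field fls set \<Rightarrow> 'k fls set" where
  "place_P F = {f\<in>F. 0 \<le> fls_subdegree f}"

definition place_ideal :: "'k::field fls set \<Rightarrow> 'k fls set" where
  "place_ideal V = {f\<in>V. f = 0 \<or> inverse f \<notin> V}"

text \<open>Unramified over the subfield \<open>K\<close>, i.e. of ramification index 1: the maximal ideal of the
  (discrete) valuation ring \<open>V\<close> is generated by an element of \<open>K\<close>. Residue field extensions play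
  no role since \<open>k\<close> will be algebraically closed.\<close>

definition unramified_over :: "'k::field fls set \<Rightarrow> 'k fls set \<Rightarrow> bool" where
  "unramified_over K V \<longleftrightarrow> (\<exists>u\<in>K. place_ideal V = (\<lambda>f. u * f) ` V)"

text \<open>The space \<open>L(nP)\<close>. Note that \<open>fls_subdegree 0 = 0\<close>.\<close>

definition LP :: "'k::field fls set \<Rightarrow> nat \<Rightarrow> 'k fls set" where
  "LP F n = {f\<in>F. (\<forall>V. is_place F V \<and> V \<noteq> place_P F \<longrightarrow> f \<in> V) \<and> - int n \<le> fls_subdegree f}"

definition polar_divisor_at_P :: "'k::field fls set \<Rightarrow> 'k fls \<Rightarrow> nat \<Rightarrow> bool" where
  "polar_divisor_at_P F f n \<longleftrightarrow> f \<in> LP F n \<and> fls_subdegree f = - int n"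

definition pole_numbers :: "'k::field fls set \<Rightarrow> nat set" where
  "pole_numbers F = {n. \<exists>f. polar_divisor_at_P F f n}"

text \<open>The increasing sequence \<open>m\<^sub>0 < m\<^sub>1 < \<dots>\<close> of pole numbers.\<close>

definition pole_seq :: "'k::field fls set \<Rightarrow> nat \<Rightarrow> nat" where
  "pole_seq F i = enumerate (pole_numbers F) i"

definition first_pole_number_prime_to :: "nat \<Rightarrow> 'k::field fls set \<Rightarrow> nat \<Rightarrow> bool" where
  "first_pole_number_prime_to p F m \<longleftrightarrow>
     m \<in> pole_numbers F \<and> \<not> p dvd m \<and> (\<forall>n\<in>pole_numbers F. n < m \<longrightarrow> p dvd n)"

section \<open>The associated HKG-cover\<close>

definition fixed_field :: "('k::field fps \<Rightarrow> 'k fps) set \<Rightarrow> 'k fls set \<Rightarrow> 'k fls set" where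
  "fixed_field G F = {f\<in>F. \<forall>\<sigma>\<in>G. fls_act \<sigma> f = f}"

text \<open>\<open>F\<close> is the function field of an HKG-cover with group \<open>G\<close>, embedded in the Laurent series field
  (its completion at \<open>P\<close>, because \<open>F\<close> contains a uniformizer) so that the action of \<open>G\<close> on \<open>F\<close> is
  the restriction of the given one. The fixed field is rational, \<open>P\<close> is totally ramified (the value
  group of the fixed field has index \<open>|G|\<close>) and wildly ramified, and all other places of \<open>F\<close> are
  unramified. That \<open>F\<close> is a function field of one variable, Galois over the fixed field with group
  \<open>G\<close>, follows from Artin's theorem.\<close>

definition HKG_cover :: "('k::field fps \<Rightarrow> 'k fps) set \<Rightarrow> 'k fls set \<Rightarrow> bool" where
  "HKG_cover G F \<longleftrightarrow> k_subfield F \<and> (\<exists>u\<in>F. fls_subdegree u = 1) \<and>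
     (\<forall>\<sigma>\<in>G. \<forall>f\<in>F. fls_act \<sigma> f \<in> F) \<and>
     (\<exists>x. k_transcendental x \<and> fixed_field G F = k_adjoin {x}) \<and>
     fls_subdegree ` (fixed_field G F - {0}) = range (\<lambda>z. int (card G) * z) \<and>
     CHAR('k) dvd card G \<and>
     (\<forall>V. is_place F V \<and> V \<noteq> place_P F \<longrightarrow> unramified_over (fixed_field G F) V)"

text \<open>The kernel of the representation \<open>\<rho>\<^sub>i\<close> of \<open>G\<close> on \<open>L(m\<^sub>iP)\<close>.\<close>

definition rho_ker :: "('k::field fps \<Rightarrow> 'k fps) set \<Rightarrow> 'k fls set \<Rightarrow> nat \<Rightarrow> ('k fps \<Rightarrow> 'k fps) set" where
  "rho_ker G F i = {\<sigma>\<in>G. \<forall>f\<in>LP F (pole_seq F i). fls_act \<sigma> f = f}"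

text \<open>The indices \<open>i < r\<close>, where \<open>m = m\<^sub>r\<close>, at which the kernel drops.\<close>

definition jumps :: "('k::field fps \<Rightarrow> 'k fps) set \<Rightarrow> 'k fls set \<Rightarrow> nat \<Rightarrow> nat set" where
  "jumps G F m = {i. pole_seq F i < m \<and> rho_ker G F (Suc i) \<subset> rho_ker G F i}"

text \<open>The group of \<open>F\<close> over \<open>F\<^sub>i\<close> for \<open>1 \<le> i \<le> s + 1\<close>, where \<open>F\<^sub>s\<^sub>+\<^sub>1 = F\<close>.\<close>

definition tower_group ::
  "('k::field fps \<Rightarrow> 'k fps) set \<Rightarrow> 'k fls set \<Rightarrow> nat \<Rightarrow> (nat \<Rightarrow> nat) \<Rightarrow> nat \<Rightarrow> ('k fps \<Rightarrow> 'k fps) set" where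
  "tower_group G F s c i = (if i \<le> s then rho_ker G F (c i) else {id})"

definition mbar :: "('k::field fps \<Rightarrow> 'k fps) set \<Rightarrow> 'k fls set \<Rightarrow> (nat \<Rightarrow> nat) \<Rightarrow> nat \<Rightarrow> nat" where
  "mbar G F c i = (if i = 0 then card G else pole_seq F (Suc (c i)))"

text \<open>The enumeration \<open>c\<^sub>1 < \<dots> < c\<^sub>s\<close> of the jumps, the functions \<open>fb 0, \<dots>, fb s\<close> and the exponents
  \<open>n\<^sub>1, \<dots>, n\<^sub>s\<close>. The group of \<open>F\<^sub>i\<^sub>+\<^sub>1\<close> over \<open>F\<^sub>i\<close> is the quotient of consecutive tower groups, so that
  \<open>p ^ n\<^sub>i\<close> is their index.\<close>

definition HKG_tower ::
  "('k::field fps \<Rightarrow> 'k fps) set \<Rightarrow> 'k fls set \<Rightarrow> nat \<Rightarrow> nat \<Rightarrow> (nat \<Rightarrow> nat) \<Rightarrow> (nat \<Rightarrow> nat) \<Rightarrow>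
   (nat \<Rightarrow> 'k fls) \<Rightarrow> bool" where
  "HKG_tower G F m s c n fb \<longleftrightarrow>
     strict_mono_on {1..s} c \<and> c ` {1..s} = jumps G F m \<and>
     fixed_field G F = k_adjoin {fb 0} \<and>
     (\<forall>i\<le>s. polar_divisor_at_P F (fb i) (mbar G F c i)) \<and>
     (\<forall>i\<in>{1..s}. card (tower_group G F s c i) =
        CHAR('k) ^ n i * card (tower_group G F s c (Suc i)))"

text \<open>The \<open>k\<close>-span of the monomials in \<open>fb 0, \<dots>, fb (s - 1)\<close> with restricted exponents and degree.\<close>

definition kspan_nm ::
  "('k::field fps \<Rightarrow> 'k fps) set \<Rightarrow> 'k fls set \<Rightarrow> nat \<Rightarrow> nat \<Rightarrow> (nat \<Rightarrow> nat) \<Rightarrow> (nat \<Rightarrow> nat) \<Rightarrow>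
   (nat \<Rightarrow> 'k fls) \<Rightarrow> 'k fls set" where
  "kspan_nm G F m s c n fb =
     {\<Sum>a\<in>A. fls_const (q a) * (\<Prod>j<s. fb j ^ a j) | A q.
        finite A \<and> (\<forall>a\<in>A. (\<forall>j\<in>{1..<s}. a j < CHAR('k) ^ n j) \<and> (\<Sum>j<s. a j * mbar G F c j) < m)}"

text \<open>1-cocycles, for the left action on Laurent series.\<close>

definition cocycles ::
  "('k::field fps \<Rightarrow> 'k fps) set \<Rightarrow> 'k fls set \<Rightarrow> (('k fps \<Rightarrow> 'k fps) \<Rightarrow> 'k fls) set" where
  "cocycles G M = {C. (\<forall>\<sigma>\<in>G. C \<sigma> \<in> M) \<and>
     (\<forall>\<sigma>\<in>G. \<forall>\<tau>\<in>G. C (\<sigma> \<circ> \<tau>) = C \<sigma> + fls_act \<sigma> (C \<tau>))}"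

section \<open>The binomial series with exponent \<open>-1/m\<close>\<close>

text \<open>In characteristic \<open>p\<close> the binomial coefficients of \<open>-1/m\<close> have to be formed in the rationals
  and then reduced; the reduction is meaningful when \<open>p\<close> does not divide the denominator.\<close>

definition rat_reduce :: "rat \<Rightarrow> 'k::field" where
  "rat_reduce x = of_int (fst (quotient_of x)) / of_int (snd (quotient_of x))"

definition binom_coeff :: "nat \<Rightarrow> nat \<Rightarrow> rat" where
  "binom_coeff m n = (- 1 / of_nat m) gchoose n"

definition binom_root :: "nat \<Rightarrow> 'k::field fps \<Rightarrow> 'k fps" where
  "binom_root m y = (Abs_fps (\<lambda>n. rat_reduce (binom_coeff m n)) oo y)"

section \<open>The map \<open>\<Phi>\<close>\<close>

text \<open>The power series \<open>C(\<sigma>) t\<^sup>m\<close>, for \<open>c = C(\<sigma>)\<close>.\<close>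

definition twist :: "'k::field fps \<Rightarrow> nat \<Rightarrow> 'k fls \<Rightarrow> 'k fps" where
  "twist t m c = fls_regpart (c * fps_to_fls t ^ m)"

definition Phi :: "'k::field fps \<Rightarrow> nat \<Rightarrow> (('k fps \<Rightarrow> 'k fps) \<Rightarrow> 'k fls) \<Rightarrow>
    ('k fps \<Rightarrow> 'k fps) \<Rightarrow> ('k fps \<Rightarrow> 'k fps)" where
  "Phi t m C \<sigma> = (THE \<phi>. \<phi> \<in> carrier fps_Aut \<and> \<phi> t = t * binom_root m (twist t m (C \<sigma>)))"

text \<open>The power series identified with an automorphism \<open>\<phi>\<close>: the image of the uniformizer \<open>t\<close>, written
  as a power series in \<open>t\<close>, i.e. the \<open>S\<close> with \<open>S(t) = \<phi>(t)\<close>.\<close>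

definition image_series :: "'k::field fps \<Rightarrow> ('k fps \<Rightarrow> 'k fps) \<Rightarrow> 'k fps" where
  "image_series t \<phi> = (\<phi> t oo fps_inv t)"

end

theory Submission
  imports Defs "HOL-Algebra.Multiplicative_Group"
begin

text \<open>\<open>\<Phi>\<close> is the identity map. From \<open>\<sigma>(t)\<^sup>-\<^sup>m = \<sigma>(fb s) = t\<^sup>-\<^sup>m + C(\<sigma>)\<close> the series
  \<open>\<sigma>(t)/t\<close> is an \<open>m\<close>-th root of \<open>(1 + C(\<sigma>) t\<^sup>m)\<^sup>-\<^sup>1\<close>. Its constant term is a character of the
  \<open>p\<close>-group \<open>G\<close> with values in a field of characteristic \<open>p\<close>, hence \<open>1\<close>, and \<open>m\<close>-th roots with
  constant term \<open>1\<close> are unique since \<open>p\<close> does not divide \<open>m\<close>; so \<open>\<sigma>(t)/t\<close> is the binomial series.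
  Automorphisms of the power series ring are substitutions, which reverses the order of products.\<close>

section \<open>Automorphisms of the power series ring are substitutions\<close>

lemma fps_Aut_iff:
  "\<phi> \<in> carrier fps_Aut \<longleftrightarrow> bij \<phi> \<and> (\<forall>f g. \<phi> (f + g) = \<phi> f + \<phi> g) \<and>
     (\<forall>f g. \<phi> (f * g) = \<phi> f * \<phi> g) \<and> (\<forall>a. \<phi> (fps_const a) = fps_const a)"
  by (simp add: fps_Aut_def)

lemma fps_Aut_simps [simp]:
  "\<phi> \<otimes>\<^bsub>fps_Aut\<^esub> \<psi> = \<phi> \<circ> \<psi>" "\<one>\<^bsub>fps_Aut\<^esub> = id"
  by (simp_all add: fps_Aut_def)

context
  fixes \<phi> :: "'k::field fps \<Rightarrow> 'k fps"
  assumes \<phi>: "\<phi> \<in> carrier fps_Aut"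
begin

lemma fps_Aut_bij: "bij \<phi>"
  and fps_Aut_add: "\<phi> (f + g) = \<phi> f + \<phi> g"
  and fps_Aut_mult: "\<phi> (f * g) = \<phi> f * \<phi> g"
  and fps_Aut_const: "\<phi> (fps_const a) = fps_const a"
  using \<phi> by (auto simp: fps_Aut_iff)

lemma fps_Aut_0: "\<phi> 0 = 0" and fps_Aut_1: "\<phi> 1 = 1"
  using fps_Aut_const[of 0] fps_Aut_const[of 1] by simp_all

lemma fps_Aut_power: "\<phi> (f ^ n) = \<phi> f ^ n"
  by (induction n) (simp_all add: fps_Aut_1 fps_Aut_mult)

lemma fps_Aut_eq_0_iff: "\<phi> f = 0 \<longleftrightarrow> f = 0"
  using fps_Aut_bij fps_Aut_0 by (metis bij_is_inj injD)

text \<open>Non-units go to non-units: a nonzero constant term would make \<open>\<phi> f\<close>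
  invertible, and bijectivity pulls its inverse back to an inverse of \<open>f\<close>.\<close>

lemma fps_Aut_nth_0_eq_0:
  assumes "f $ 0 = 0"
  shows "\<phi> f $ 0 = 0"
proof (rule ccontr)
  assume "\<phi> f $ 0 \<noteq> 0"
  then have 1: "\<phi> f * inverse (\<phi> f) = 1"
    by (simp add: inverse_mult_eq_1')
  obtain g where "inverse (\<phi> f) = \<phi> g"
    using fps_Aut_bij by (metis bij_pointE)
  with 1 have "\<phi> (f * g) = \<phi> 1"
    by (simp add: fps_Aut_mult fps_Aut_1)
  then have "f * g = 1"
    using fps_Aut_bij by (metis bij_is_inj injD)
  then have "f $ 0 * g $ 0 = 1"
    by (metis fps_mult_nth_0 fps_one_nth)
  with assms show False by simp
qed

lemma fps_Aut_nth_0: "\<phi> f $ 0 = f $ 0"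
proof -
  have "\<phi> f = \<phi> (f - fps_const (f $ 0)) + fps_const (f $ 0)"
    by (metis fps_Aut_add fps_Aut_const diff_add_cancel)
  moreover have "\<phi> (f - fps_const (f $ 0)) $ 0 = 0"
    by (rule fps_Aut_nth_0_eq_0) simp
  ultimately show ?thesis by simp
qed

text \<open>Continuity is automatic: the two sides differ by a multiple of every power of
  \<open>\<phi> h\<close>, which has zero constant term, so they agree in every coefficient.\<close>

lemma fps_Aut_compose:
  assumes h: "h $ 0 = 0"
  shows "\<phi> (g oo h) = g oo \<phi> h"
proof -
  have h': "\<phi> h $ 0 = 0"
    using h by (rule fps_Aut_nth_0_eq_0)
  \<comment> \<open>The series \<open>g\<close> stays general, since the induction passes from
    \<open>g\<close> to its shift after splitting off the constant term.\<close>
  have approx: "\<exists>r. \<phi> (g oo h) - (g oo \<phi> h) = \<phi> h ^ n * r" for n g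
  proof (induction n arbitrary: g)
    case (Suc n)
    define g' where "g' = fps_shift 1 g"
    have g: "g = fps_const (g $ 0) + fps_X * g'"
      by (rule fps_ext) (auto simp: g'_def)
    have split: "g oo x = fps_const (g $ 0) + x * (g' oo x)" if "x $ 0 = 0" for x
      by (subst g) (use that in \<open>simp add: fps_compose_add_distrib fps_compose_mult_distrib\<close>)
    obtain r where r: "\<phi> (g' oo h) - (g' oo \<phi> h) = \<phi> h ^ n * r"
      using Suc by blast
    have "\<phi> (g oo h) - (g oo \<phi> h) = \<phi> h * (\<phi> (g' oo h) - (g' oo \<phi> h))"
      by (simp add: split h h' fps_Aut_add fps_Aut_mult fps_Aut_const algebra_simps)
    then show ?case
      by (auto simp: r mult.assoc)
  qed simp
  have "(\<phi> (g oo h) - (g oo \<phi> h)) $ n = 0" for n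
  proof -
    obtain r where r: "\<phi> (g oo h) - (g oo \<phi> h) = \<phi> h ^ Suc n * r"
      using approx by blast
    \<comment> \<open>One factor \<open>fps_X\<close> in \<open>\<phi> h\<close> makes its power
      \<open>Suc n\<close> divisible by that of \<open>fps_X\<close>, which kills coefficient
      \<open>n\<close>.\<close>
    have X: "\<phi> h = fps_X * fps_shift 1 (\<phi> h)"
      by (rule fps_ext) (use h' in auto)
    show ?thesis
      by (subst r, subst X) (simp add: power_mult_distrib mult.assoc fps_X_power_mult_nth del: power_Suc)
  qed
  then show ?thesis
    by (simp add: fps_eq_iff)
qed

section \<open>The induced action on Laurent series\<close>

lemma fls_act_mult: "fls_act \<phi> (f * g) = fls_act \<phi> f * fls_act \<phi> g"
proof (cases "f = 0 \<or> g = 0")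
  \<comment> \<open>Zero is treated apart because subdegrees add only for nonzero factors.\<close>
  case True
  then show ?thesis
    by (auto simp: fls_act_def fps_Aut_0)
next
  case False
  then show ?thesis
    unfolding fls_act_def fls_base_factor_to_fps_mult fps_Aut_mult fls_times_fps_to_fls
    by (simp add: fps_Aut_eq_0_iff power_int_add)
qed

lemma fls_act_1: "fls_act \<phi> 1 = 1"
  by (simp add: fls_act_def fps_Aut_1)

lemma fls_act_inverse: "fls_act \<phi> (inverse f) = inverse (fls_act \<phi> f)"
proof (cases "f = 0")
  case True
  then show ?thesis by (simp add: fls_act_def fps_Aut_0)
next
  case False
  then have "fls_act \<phi> f * fls_act \<phi> (inverse f) = 1"
    by (simp flip: fls_act_mult add: fls_act_1)
  then show ?thesis
    by (simp add: inverse_unique)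
qed

lemma fls_act_power: "fls_act \<phi> (f ^ n) = fls_act \<phi> f ^ n"
  by (induction n) (simp_all add: fls_act_1 fls_act_mult)

lemma fls_act_power_int: "fls_act \<phi> (f powi n) = fls_act \<phi> f powi n"
  by (simp add: power_int_def fls_act_power fls_act_inverse)

text \<open>Splitting off the power of \<open>fps_X\<close> from a power series shows that the
  action on Laurent series really extends \<open>\<phi>\<close>.\<close>

lemma fls_act_fps_to_fls: "fls_act \<phi> (fps_to_fls f) = fps_to_fls (\<phi> f)"
proof -
  have "f = fps_X ^ subdegree f * unit_factor f"
    by (metis fps_unit_factor_decompose mult.commute)
  then have "\<phi> f = \<phi> fps_X ^ subdegree f * \<phi> (unit_factor f)"
    by (metis fps_Aut_mult fps_Aut_power)
  then show ?thesis
    unfolding fls_act_def fls_base_factor_to_fps_to_fls fls_subdegree_fls_to_fps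
    by (simp add: fls_times_fps_to_fls fps_to_fls_power)
qed

end

section \<open>Uniformizers and the group of automorphisms\<close>

lemma subdegree_eq_1D:
  assumes "subdegree t = 1"
  shows "t $ 0 = 0" and "t $ 1 \<noteq> 0"
  using assms by (metis nth_less_subdegree_zero zero_less_one,
      metis nth_subdegree_nonzero subdegree_0 zero_neq_one)

lemma fps_inv_nth_0: "fps_inv t $ 0 = 0"
  by (simp add: fps_inv_def)

text \<open>Every power series is a series in the uniformizer \<open>t\<close>, namely
  \<open>f oo fps_inv t\<close> evaluated at \<open>t\<close>, and automorphisms commute with
  substitution.\<close>

lemma fps_Aut_eqI:
  assumes \<phi>: "\<phi> \<in> carrier fps_Aut" and \<psi>: "\<psi> \<in> carrier fps_Aut"
    and t: "subdegree t = 1" and eq: "\<phi> t = \<psi> t"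
  shows "\<phi> = \<psi>"
proof
  fix f :: "'a fps"
  have t0: "t $ 0 = 0" and t1: "t $ 1 \<noteq> 0"
    using subdegree_eq_1D[OF t] by simp_all
  have "f = (f oo fps_inv t) oo t"
    using fps_compose_assoc[OF t0 fps_inv_nth_0, of f t]
    by (simp only: fps_inv[OF t0 t1] fps_compose_fps_X)
  then show "\<phi> f = \<psi> f"
    by (metis fps_Aut_compose \<phi> \<psi> eq t0)
qed

lemma group_fps_Aut: "group (fps_Aut :: ('k::field fps \<Rightarrow> 'k fps) monoid)"
proof (rule groupI)
  fix \<phi> :: "'k fps \<Rightarrow> 'k fps"
  assume \<phi>: "\<phi> \<in> carrier fps_Aut"
  have bij: "bij \<phi>" using \<phi> by (rule fps_Aut_bij)
  have r: "\<phi> (inv_into UNIV \<phi> f) = f" for f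
    using bij by (simp add: bij_is_surj surj_f_inv_f)
  have inj: "\<phi> f = \<phi> g \<Longrightarrow> f = g" for f g
    using bij by (simp add: bij_is_inj inj_eq)
  have "inv_into UNIV \<phi> \<in> carrier fps_Aut"
    unfolding fps_Aut_iff
  proof (intro conjI allI)
    show "bij (inv_into UNIV \<phi>)"
      using bij by (rule bij_imp_bij_inv)
  \<comment> \<open>Each identity for the inverse map is checked after applying \<phi> to both
    sides.\<close>
  qed (rule inj, simp add: r fps_Aut_add[OF \<phi>] fps_Aut_mult[OF \<phi>] fps_Aut_const[OF \<phi>])+
  then show "\<exists>\<psi>\<in>carrier fps_Aut. \<psi> \<otimes>\<^bsub>fps_Aut\<^esub> \<phi> = \<one>\<^bsub>fps_Aut\<^esub>"
    using bij by (intro bexI[of _ "inv_into UNIV \<phi>"]) (auto simp: bij_is_inj)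
qed (auto simp: fps_Aut_iff bij_comp)

text \<open>Automorphisms preserve constant terms, so iterating \<sigma> raises \<open>w $ 0\<close>
  to powers. Since \<sigma> has order dividing \<open>card G\<close>, this constant is a root of
  unity of p-power order, and in characteristic p only 1 is such a root.\<close>

lemma p_group_fps_Aut_tangent:
  fixes G :: "('k::field fps \<Rightarrow> 'k fps) set"
  assumes p: "prime CHAR('k)" and G: "subgroup G fps_Aut" and card: "card G = CHAR('k) ^ e"
    and \<sigma>: "\<sigma> \<in> G" and t: "t \<noteq> 0" and w: "\<sigma> t = t * w"
  shows "w $ 0 = 1"
proof -
  interpret A: group "fps_Aut :: ('k fps \<Rightarrow> 'k fps) monoid"
    by (rule group_fps_Aut)
  interpret H: group "fps_Aut\<lparr>carrier := G\<rparr>"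
    using G by (rule A.subgroup_imp_group)
  have Aut: "\<sigma> \<in> carrier fps_Aut"
    using \<sigma> G by (rule subgroup.mem_carrier[rotated])
  have pow: "\<exists>v. (\<sigma> ^^ n) t = t * v \<and> v $ 0 = (w $ 0) ^ n" for n
  proof (induction n)
    case (Suc n)
    then obtain v where v: "(\<sigma> ^^ n) t = t * v" "v $ 0 = (w $ 0) ^ n"
      by blast
    have "(\<sigma> ^^ Suc n) t = t * (w * \<sigma> v)"
      using v by (simp add: fps_Aut_mult[OF Aut] w mult.assoc)
    then show ?case
      using v by (intro exI[of _ "w * \<sigma> v"]) (simp add: fps_Aut_nth_0[OF Aut])
  qed (auto intro: exI[of _ 1])
  have npow: "\<sigma> [^]\<^bsub>fps_Aut\<lparr>carrier := G\<rparr>\<^esub> n = \<sigma> ^^ n" for n :: nat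
    by (induction n) (simp_all add: funpow_Suc_right del: funpow.simps(2))
  have "\<sigma> ^^ card G = id"
    using H.pow_order_eq_1[of \<sigma>] \<sigma> by (simp add: npow order_def)
  then obtain v where "t = t * v" "v $ 0 = (w $ 0) ^ card G"
    using pow[of "card G"] by auto
  then have "(w $ 0) ^ (CHAR('k) ^ e) = 1"
    using t card by (metis fps_one_nth mult_cancel_left1)
  \<comment> \<open>Additivity of Frobenius is applied to \<open>w $ 0\<close> written as
    \<open>(w $ 0 - 1) + 1\<close>, so that \<open>w $ 0 - 1\<close> becomes nilpotent.\<close>
  moreover have "(w $ 0) ^ (CHAR('k) ^ e) = (w $ 0 - 1) ^ (CHAR('k) ^ e) + 1 ^ (CHAR('k) ^ e)"
    using freshmans_dream'[OF p refl, of "w $ 0 - 1" 1 e] by simp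
  ultimately show ?thesis by simp
qed

section \<open>The binomial series in positive characteristic\<close>

text \<open>For prime p this is the localization of the integers at p, since
  \<open>quotient_of\<close> gives the fraction in lowest terms.\<close>

definition p_integral :: "nat \<Rightarrow> rat \<Rightarrow> bool" where
  "p_integral p x \<longleftrightarrow> \<not> int p dvd snd (quotient_of x)"

lemma p_integral_cases:
  assumes "p_integral p x"
  obtains a b where "x = of_int a / of_int b" "\<not> int p dvd b"
  using assms quotient_of_div[of x] by (metis p_integral_def prod.collapse)

text \<open>Relates an arbitrary fraction to its lowest terms, so that later arguments may use any
  denominator prime to p.\<close>

lemma quotient_of_of_int_divide:
  assumes "b \<noteq> 0"
  shows "snd (quotient_of (of_int a / of_int b)) dvd b"
    and "a * snd (quotient_of (of_int a / of_int b)) = fst (quotient_of (of_int a / of_int b)) * b"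
proof -
  obtain c d where q: "quotient_of (of_int a / of_int b) = (c, d)"
    by fastforce
  have d: "d > 0" "coprime c d"
    using q quotient_of_denom_pos quotient_of_coprime by auto
  have "(of_int a / of_int b :: rat) = of_int c / of_int d"
    using q by (rule quotient_of_div)
  then have "(of_int (a * d) :: rat) = of_int (c * b)"
    using d assms by (simp add: field_simps)
  then have eq: "a * d = c * b"
    by (simp only: of_int_eq_iff)
  then have "d dvd c * b"
    by (metis dvd_triv_right)
  with d have "d dvd b"
    by (simp add: coprime_commute coprime_dvd_mult_right_iff)
  then show "snd (quotient_of (of_int a / of_int b)) dvd b"
    and "a * snd (quotient_of (of_int a / of_int b)) = fst (quotient_of (of_int a / of_int b)) * b"
    using q eq by simp_all
qed

lemma p_integral_of_int_divide:
  assumes "\<not> int p dvd b"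
  shows "p_integral p (of_int a / of_int b)"
proof -
  have "b \<noteq> 0" using assms by auto
  with assms show ?thesis
    unfolding p_integral_def using quotient_of_of_int_divide(1) dvd_trans by blast
qed

lemma rat_reduce_of_int_divide:
  assumes "\<not> int CHAR('k) dvd b"
  shows "rat_reduce (of_int a / of_int b) = (of_int a / of_int b :: 'k::field)"
proof -
  let ?q = "quotient_of (of_int a / of_int b)"
  have "b \<noteq> 0" using assms by auto
  have "\<not> int CHAR('k) dvd snd ?q"
    using p_integral_of_int_divide[OF assms] by (simp add: p_integral_def)
  then have "(of_int (snd ?q) :: 'k) \<noteq> 0" "(of_int b :: 'k) \<noteq> 0"
    using assms by (simp_all add: of_int_eq_0_iff_char_dvd)
  moreover have "(of_int a * of_int (snd ?q) :: 'k) = of_int (fst ?q) * of_int b"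
    using quotient_of_of_int_divide(2)[OF \<open>b \<noteq> 0\<close>, of a] by (metis of_int_mult)
  ultimately show ?thesis
    by (simp add: rat_reduce_def field_simps)
qed

lemma p_integral_of_int: "prime p \<Longrightarrow> p_integral p (of_int a)"
  using p_integral_of_int_divide[of p 1 a] by (simp add: prime_nat_iff)

context
  fixes p :: nat
  assumes p: "prime p"
begin

lemma not_p_dvd_mult: "\<not> int p dvd a \<Longrightarrow> \<not> int p dvd b \<Longrightarrow> \<not> int p dvd a * b"
  using p by (simp add: prime_dvd_mult_iff)

lemma of_int_divide_add_mult:
  assumes "\<not> int p dvd b" "\<not> int p dvd d"
  shows "of_int a / of_int b + of_int c / of_int d = (of_int (a * d + c * b) / of_int (b * d) :: rat)"
    and "of_int a / of_int b * (of_int c / of_int d) = (of_int (a * c) / of_int (b * d) :: rat)"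
proof -
  have "b \<noteq> 0" "d \<noteq> 0" using assms by auto
  then show "of_int a / of_int b + of_int c / of_int d = (of_int (a * d + c * b) / of_int (b * d) :: rat)"
    and "of_int a / of_int b * (of_int c / of_int d) = (of_int (a * c) / of_int (b * d) :: rat)"
    by (simp_all add: field_simps)
qed

lemma p_integral_add: "p_integral p x \<Longrightarrow> p_integral p y \<Longrightarrow> p_integral p (x + y)"
  by (elim p_integral_cases)
    (simp only: of_int_divide_add_mult p_integral_of_int_divide not_p_dvd_mult not_False_eq_True)

lemma p_integral_mult: "p_integral p x \<Longrightarrow> p_integral p y \<Longrightarrow> p_integral p (x * y)"
  by (elim p_integral_cases)
    (simp only: of_int_divide_add_mult p_integral_of_int_divide not_p_dvd_mult not_False_eq_True)

lemma p_integral_diff: "p_integral p x \<Longrightarrow> p_integral p y \<Longrightarrow> p_integral p (x - y)"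
  using p_integral_add[of x "of_int (-1) * y"] p_integral_mult[of "of_int (-1)" y]
    p_integral_of_int[OF p, of "-1"] by simp

lemma p_integral_sum: "(\<And>i. i \<in> A \<Longrightarrow> p_integral p (f i)) \<Longrightarrow> p_integral p (sum f A)"
  using p_integral_of_int[OF p, of 0]
  by (induction A rule: infinite_finite_induct) (auto intro: p_integral_add)

lemma p_integral_fps_mult:
  "(\<And>n. p_integral p (f $ n)) \<Longrightarrow> (\<And>n. p_integral p (g $ n)) \<Longrightarrow> p_integral p ((f * g) $ n)"
  by (auto simp: fps_mult_nth intro!: p_integral_sum p_integral_mult)

lemma p_integral_fps_power:
  assumes "\<And>n. p_integral p (f $ n)"
  shows "p_integral p ((f ^ j) $ n)"
proof (induction j arbitrary: n)
  case 0
  then show ?case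
    using p_integral_of_int[OF p, of 0] p_integral_of_int[OF p, of 1] by simp
next
  case (Suc j)
  then show ?case
    using assms by (auto intro: p_integral_fps_mult)
qed

text \<open>The \<open>n\<close>-th coefficient of \<open>R\<^sup>m\<close> is \<open>m R\<^sub>n\<close> plus a term in the lower coefficients of \<open>R\<close>.\<close>

lemma p_integral_fps_root:
  assumes m: "\<not> p dvd m" and Q: "\<And>n. p_integral p ((R ^ m) $ n)" and R0: "R $ 0 = 1"
  shows "p_integral p (R $ n)"
proof (induction n rule: less_induct)
  case (less n)
  show ?case
  proof (cases "n = 0")
    case True
    then show ?thesis
      using R0 p_integral_of_int[OF p, of 1] by simp
  next
    case False
    \<comment> \<open>Truncation below degree \<open>n\<close> and the shifted remainder, whose
      constant term is \<open>R $ n\<close>.\<close>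
    define L S where "L = fps_cutoff n R" and "S = fps_shift n R"
    have R: "R = L + S * fps_X ^ n"
      unfolding L_def S_def using fps_shift_cutoff[of n R] by (simp only: add.commute)
    have L0: "L $ 0 = 1"
      using False R0 by (simp add: L_def)
    have "R ^ m - L ^ m = (R - L) * (\<Sum>i<m. L ^ (m - Suc i) * R ^ i)"
      by (rule power_diff_sumr2)
    also have "R - L = fps_X ^ n * S"
      using R by (simp add: algebra_simps)
    finally have "(R ^ m - L ^ m) $ n = (S * (\<Sum>i<m. L ^ (m - Suc i) * R ^ i)) $ 0"
      by (simp add: mult.assoc fps_X_power_mult_nth)
    \<comment> \<open>Only constant terms enter; each of the \<open>m\<close> summands contributes
      1.\<close>
    also have "\<dots> = R $ n * of_nat m"
      by (simp add: fps_sum_nth L0 R0 S_def fps_power_zeroth)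
    finally have "R $ n * of_nat m = (R ^ m) $ n - (L ^ m) $ n"
      by simp
    moreover have "m \<noteq> 0" using m by (intro notI) simp
    ultimately have "R $ n = ((R ^ m) $ n - (L ^ m) $ n) * (of_int 1 / of_int (int m))"
      by (simp add: field_simps)
    \<comment> \<open>Coefficients of \<open>L\<close> below \<open>n\<close> are those of
      \<open>R\<close>, covered by induction; the others are 0.\<close>
    moreover have "p_integral p (L $ i)" for i
      using less p_integral_of_int[OF p, of 0] by (simp add: L_def)
    then have "p_integral p ((L ^ m) $ n)"
      by (rule p_integral_fps_power)
    moreover have "p_integral p (of_int 1 / of_int (int m))"
      using m by (intro p_integral_of_int_divide) simp
    ultimately show ?thesis
      using Q by (simp only: p_integral_mult p_integral_diff)
  qed
qed

end

section \<open>The binomial series over the rationals\<close>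

definition binom_fps :: "nat \<Rightarrow> rat fps" where
  "binom_fps m = fps_binomial (- 1 / of_nat m)"

lemma binom_fps_nth: "binom_fps m $ n = binom_coeff m n"
  by (simp add: binom_fps_def binom_coeff_def)

lemma binom_fps_power:
  assumes "m \<noteq> 0"
  shows "binom_fps m ^ m = inverse (1 + fps_X)"
  using assms by (simp add: binom_fps_def fps_binomial_power fps_binomial_minus_one)

text \<open>The \<open>m\<close>-th power of the series is the inverse of \<open>1 + fps_X\<close>,
  with coefficients 1 and -1, and extracting the root divides only by \<open>m\<close>, which is
  prime to p.\<close>

lemma p_integral_binom_coeff:
  assumes "prime p" "\<not> p dvd m"
  shows "p_integral p (binom_coeff m n)"
proof -
  have "m \<noteq> 0" using assms by (intro notI) simp
  have "p_integral p ((binom_fps m ^ m) $ n)" for n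
    using p_integral_of_int[OF assms(1), of "(- 1) ^ n"]
    by (simp add: binom_fps_power[OF \<open>m \<noteq> 0\<close>] fps_inverse_fps_X_plus1)
  then have "p_integral p (binom_fps m $ n)"
    by (rule p_integral_fps_root[OF assms]) (simp add: binom_fps_def)
  then show ?thesis by (simp add: binom_fps_nth)
qed

section \<open>Reduction modulo the characteristic\<close>

context
  assumes p: "prime CHAR('k::field)"
begin

lemma rat_reduce_of_int: "rat_reduce (of_int a) = (of_int a :: 'k)"
  using rat_reduce_of_int_divide[where 'k = 'k, of 1 a] p by (simp add: prime_nat_iff)

lemma rat_reduce_add:
  assumes "p_integral CHAR('k) x" "p_integral CHAR('k) y"
  shows "rat_reduce (x + y) = (rat_reduce x + rat_reduce y :: 'k)"
proof -
  obtain a b where x: "x = of_int a / of_int b" "\<not> int CHAR('k) dvd b"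
    using assms(1) by (rule p_integral_cases)
  obtain c d where y: "y = of_int c / of_int d" "\<not> int CHAR('k) dvd d"
    using assms(2) by (rule p_integral_cases)
  have "(of_int b :: 'k) \<noteq> 0" "(of_int d :: 'k) \<noteq> 0"
    using x y by (simp_all add: of_int_eq_0_iff_char_dvd)
  then show ?thesis
    unfolding x(1) y(1) of_int_divide_add_mult[OF p x(2) y(2)]
      rat_reduce_of_int_divide[OF x(2)] rat_reduce_of_int_divide[OF y(2)]
      rat_reduce_of_int_divide[OF not_p_dvd_mult[OF p x(2) y(2)]]
    by (simp add: field_simps)
qed

lemma rat_reduce_mult:
  assumes "p_integral CHAR('k) x" "p_integral CHAR('k) y"
  shows "rat_reduce (x * y) = (rat_reduce x * rat_reduce y :: 'k)"
proof -
  obtain a b where x: "x = of_int a / of_int b" "\<not> int CHAR('k) dvd b"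
    using assms(1) by (rule p_integral_cases)
  obtain c d where y: "y = of_int c / of_int d" "\<not> int CHAR('k) dvd d"
    using assms(2) by (rule p_integral_cases)
  show ?thesis
    unfolding x(1) y(1) of_int_divide_add_mult[OF p x(2) y(2)]
      rat_reduce_of_int_divide[OF x(2)] rat_reduce_of_int_divide[OF y(2)]
      rat_reduce_of_int_divide[OF not_p_dvd_mult[OF p x(2) y(2)]]
    by simp
qed

lemma rat_reduce_sum:
  assumes "\<And>i. i \<in> A \<Longrightarrow> p_integral CHAR('k) (f i)"
  shows "rat_reduce (sum f A) = (\<Sum>i\<in>A. rat_reduce (f i) :: 'k)"
  using assms rat_reduce_of_int[of 0]
  by (induction A rule: infinite_finite_induct) (simp_all add: rat_reduce_add p_integral_sum[OF p])

text \<open>Coefficientwise reduction; it respects products only for p-integral series, hence the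
  hypotheses below.\<close>

definition fps_reduce :: "rat fps \<Rightarrow> 'k fps" where
  "fps_reduce f = Abs_fps (\<lambda>n. rat_reduce (f $ n))"

lemma fps_reduce_mult:
  assumes "\<And>n. p_integral CHAR('k) (f $ n)" "\<And>n. p_integral CHAR('k) (g $ n)"
  shows "fps_reduce (f * g) = fps_reduce f * fps_reduce g"
  by (rule fps_ext)
    (simp add: fps_reduce_def fps_mult_nth rat_reduce_sum rat_reduce_mult p_integral_mult[OF p] assms)

lemma fps_reduce_1: "fps_reduce 1 = 1"
  by (rule fps_ext) (use rat_reduce_of_int[of 0] rat_reduce_of_int[of 1] in \<open>simp add: fps_reduce_def\<close>)

lemma fps_reduce_power:
  assumes "\<And>n. p_integral CHAR('k) (f $ n)"
  shows "fps_reduce (f ^ j) = fps_reduce f ^ j"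
  by (induction j)
    (simp_all add: fps_reduce_1 fps_reduce_mult p_integral_fps_power[OF p] assms)

lemma fps_reduce_binom_fps_power:
  assumes "\<not> CHAR('k) dvd m"
  shows "fps_reduce (binom_fps m) ^ m * (1 + fps_X) = 1"
proof -
  have "m \<noteq> 0" using assms by (intro notI) simp
  have int: "p_integral CHAR('k) (binom_fps m $ n)" for n
    using p_integral_binom_coeff[OF p assms] by (simp add: binom_fps_nth)
  have int': "p_integral CHAR('k) ((1 + fps_X :: rat fps) $ n)" for n
    using p_integral_of_int[OF p, of 0] p_integral_of_int[OF p, of 1] by simp
  have X: "fps_reduce (1 + fps_X) = 1 + fps_X"
    by (rule fps_ext) (use rat_reduce_of_int[of 0] rat_reduce_of_int[of 1] in \<open>simp add: fps_reduce_def\<close>)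
  \<comment> \<open>A product equation over the rationals can be reduced using multiplicativity
    alone, without reducing inverses.\<close>
  have "binom_fps m ^ m * (1 + fps_X) = 1"
    by (simp add: binom_fps_power[OF \<open>m \<noteq> 0\<close>] inverse_mult_eq_1)
  then have "fps_reduce (binom_fps m ^ m * (1 + fps_X)) = 1"
    by (simp add: fps_reduce_1)
  then show ?thesis
    by (simp only: fps_reduce_mult[OF p_integral_fps_power[OF p int] int'] fps_reduce_power[OF int] X)
qed

text \<open>Substituting a series without constant term is a ring homomorphism, so the identity for
  \<open>fps_X\<close> carries over to \<open>y\<close>.\<close>

lemma binom_root_power:
  fixes y :: "'k fps"
  assumes m: "\<not> CHAR('k) dvd m" and y: "y $ 0 = 0"
  shows "binom_root m y ^ m * (1 + y) = 1"
proof -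
  have "binom_root m y ^ m * (1 + y) = (fps_reduce (binom_fps m) ^ m * (1 + fps_X)) oo y"
    using y by (simp add: binom_root_def fps_reduce_def binom_fps_nth fps_compose_mult_distrib
        fps_compose_add_distrib fps_compose_power)
  then show ?thesis
    by (simp add: fps_reduce_binom_fps_power[OF m])
qed

lemma binom_root_nth_0: "binom_root m y $ 0 = (1 :: 'k)"
  using rat_reduce_of_int[of 1] by (simp add: binom_root_def binom_coeff_def)

end

text \<open>In the factorization of \<open>v ^ m - w ^ m\<close> the cofactor of
  \<open>v - w\<close> has constant term \<open>m\<close>, nonzero in the field, and power series
  form a domain.\<close>

lemma fps_root_unique:
  fixes v w :: "'k::field fps"
  assumes m: "\<not> CHAR('k) dvd m" and eq: "v ^ m = w ^ m" and 1: "v $ 0 = 1" "w $ 0 = 1"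
  shows "v = w"
proof -
  let ?S = "\<Sum>i<m. w ^ (m - Suc i) * v ^ i"
  have "?S $ 0 = of_nat m"
    by (simp add: fps_sum_nth fps_power_zeroth 1)
  then have "?S \<noteq> 0"
    using m by (metis fps_zero_nth of_nat_eq_0_iff_char_dvd)
  moreover have "(v - w) * ?S = 0"
    using eq by (simp flip: power_diff_sumr2)
  ultimately show ?thesis by simp
qed

section \<open>The map \<open>\<Phi>\<close>\<close>

theorem theorem21:
  fixes G :: "('k::alg_closed_field fps \<Rightarrow> 'k fps) set"
    and F :: "'k fls set"
    and fb :: "nat \<Rightarrow> 'k fls"
    and C :: "('k fps \<Rightarrow> 'k fps) \<Rightarrow> 'k fls"
    and t :: "'k fps"
    and p m s :: nat
    and c n :: "nat \<Rightarrow> nat"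
  assumes char: "prime p" "CHAR('k) = p" "p \<ge> 5"
    and G: "subgroup G fps_Aut" "finite G" "\<exists>e. card G = p ^ e"
    and cover: "HKG_cover G F"
    and m: "first_pole_number_prime_to p F m"
    and tower: "HKG_tower G F m s c n fb"
    and C: "C \<in> cocycles G (kspan_nm G F m s c n fb)"
    and C_eq: "\<And>\<sigma>. \<sigma> \<in> G \<Longrightarrow> C \<sigma> = fls_act \<sigma> (fb s) - fb s"
    and t: "subdegree t = 1" "fps_to_fls t powi (- int m) = fb s"
  shows "(\<forall>\<sigma>\<in>G. fps_to_fls (twist t m (C \<sigma>)) = C \<sigma> * fps_to_fls t ^ m \<and> twist t m (C \<sigma>) $ 0 = 0)
    \<and> (\<forall>i. \<not> int p dvd snd (quotient_of (binom_coeff m i)))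
    \<and> (\<forall>\<sigma>\<in>G. binom_root m (twist t m (C \<sigma>)) ^ m * (1 + twist t m (C \<sigma>)) = 1
          \<and> binom_root m (twist t m (C \<sigma>)) $ 0 = 1)
    \<and> (\<forall>\<sigma>\<in>G. \<exists>!\<phi>. \<phi> \<in> carrier fps_Aut \<and> \<phi> t = t * binom_root m (twist t m (C \<sigma>)))
    \<and> (\<forall>\<sigma>\<in>G. \<forall>\<tau>\<in>G. image_series t (Phi t m C (\<tau> \<circ> \<sigma>))
          = (image_series t (Phi t m C \<sigma>) oo image_series t (Phi t m C \<tau>)))
    \<and> inj_on (Phi t m C) G"
proof -
  have p: "prime CHAR('k)" using char by simp
  have pm: "\<not> CHAR('k) dvd m"
    using m char by (simp add: first_pole_number_prime_to_def)
  have t_nz: "t \<noteq> 0" using t by auto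
  have t0: "t $ 0 = 0" and t1: "t $ 1 \<noteq> 0"
    using subdegree_eq_1D[OF t(1)] by simp_all
  have Aut: "\<sigma> \<in> carrier fps_Aut" if "\<sigma> \<in> G" for \<sigma>
    using G(1) that by (rule subgroup.mem_carrier)

  have key: "fps_to_fls (twist t m (C \<sigma>)) = C \<sigma> * fps_to_fls t ^ m \<and> twist t m (C \<sigma>) $ 0 = 0 \<and>
      \<sigma> t = t * binom_root m (twist t m (C \<sigma>))" if \<sigma>: "\<sigma> \<in> G" for \<sigma>
  proof -
    have "\<sigma> t $ 0 = 0"
      using t0 by (rule fps_Aut_nth_0_eq_0[OF Aut[OF \<sigma>]])
    then have "\<sigma> t = fps_X * fps_shift 1 (\<sigma> t)"
      by (intro fps_ext) auto
    moreover have "t = fps_X * fps_shift 1 t"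
      using t0 by (intro fps_ext) auto
    moreover have "fps_shift 1 t $ 0 \<noteq> 0" using t1 by simp
    \<comment> \<open>Both series are divisible by \<open>fps_X\<close>, and \<open>t\<close>
      divided by \<open>fps_X\<close> is a unit.\<close>
    ultimately have "\<sigma> t = t * (inverse (fps_shift 1 t) * fps_shift 1 (\<sigma> t))"
      by (metis inverse_mult_eq_1' mult.assoc mult.left_neutral)
    then obtain w where w: "\<sigma> t = t * w" by blast
    have w0: "w $ 0 = 1"
      using G(3) char(2) p_group_fps_Aut_tangent[OF p G(1) _ \<sigma> t_nz w] by auto
    \<comment> \<open>The series that \<open>C \<sigma> * t ^ m\<close> will turn out to be:
      \<open>\<sigma> t = t * w\<close> gives \<open>fb s\<close> the image
      \<open>t ^ (-m) * w ^ (-m)\<close>.\<close>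
    define y where "y = inverse (w ^ m) - 1"
    have wy: "w ^ m * (1 + y) = 1"
      using w0 by (simp add: y_def inverse_mult_eq_1' fps_power_zeroth)
    let ?t = "fps_to_fls t" and ?w = "fps_to_fls w"
    have "C \<sigma> = fps_to_fls (\<sigma> t) powi (- int m) - ?t powi (- int m)"
      using C_eq[OF \<sigma>] Aut[OF \<sigma>] by (simp flip: t(2) add: fls_act_power_int fls_act_fps_to_fls)
    also have "\<dots> = inverse (?t ^ m) * (inverse (?w ^ m) - 1)"
      by (simp add: w power_int_minus fls_times_fps_to_fls power_mult_distrib algebra_simps)
    also have "inverse (?w ^ m) = 1 + fps_to_fls y"
    proof -
      have "?w ^ m * (1 + fps_to_fls y) = fps_to_fls (w ^ m * (1 + y))"
        by (simp add: fls_times_fps_to_fls fps_to_fls_power)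
      then show ?thesis
        unfolding wy by (simp add: inverse_unique)
    qed
    finally have Ct: "C \<sigma> * ?t ^ m = fps_to_fls y"
      using t_nz by simp
    \<comment> \<open>Taking the regular part loses nothing, as the product is already a power
      series.\<close>
    then have tw: "twist t m (C \<sigma>) = y"
      by (simp add: twist_def)
    have y0: "y $ 0 = 0"
      using w0 by (simp add: y_def fps_power_zeroth)
    have "w = binom_root m y"
    proof (rule fps_root_unique[OF pm _ w0 binom_root_nth_0[OF p]])
      \<comment> \<open>Both powers are inverse to \<open>1 + y\<close>.\<close>
      show "w ^ m = binom_root m y ^ m"
        using wy binom_root_power[OF p pm y0] by (metis mult_cancel_right mult_zero_right zero_neq_one)
    qed
    with w tw Ct y0 show ?thesis by simp
  qed

  have unique: "\<exists>!\<phi>. \<phi> \<in> carrier fps_Aut \<and> \<phi> t = t * binom_root m (twist t m (C \<sigma>))"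
    if "\<sigma> \<in> G" for \<sigma>
    using key[OF that] Aut[OF that] t(1) by (auto intro: fps_Aut_eqI)
  \<comment> \<open>The given \<sigma> satisfies the defining property, so the unique choice returns
    it; injectivity is then immediate.\<close>
  have Phi: "Phi t m C \<sigma> = \<sigma>" if "\<sigma> \<in> G" for \<sigma>
    unfolding Phi_def using key[OF that] Aut[OF that] by (intro the1_equality unique that) simp

  have comp: "image_series t (\<tau> \<circ> \<sigma>) = (image_series t \<sigma> oo image_series t \<tau>)"
    if "\<sigma> \<in> G" "\<tau> \<in> G" for \<sigma> \<tau>
  proof -
    have \<tau>t: "\<tau> t $ 0 = 0"
      using t0 by (rule fps_Aut_nth_0_eq_0[OF Aut[OF that(2)]])
    have "\<sigma> t = image_series t \<sigma> oo t"
      using fps_compose_assoc[OF t0 fps_inv_nth_0, of "\<sigma> t" t]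
      by (simp only: image_series_def fps_inv[OF t0 t1] fps_compose_fps_X)
    \<comment> \<open>Here the order reverses: \<tau> fixes the coefficients of the series of
      \<sigma> and moves only its argument \<open>t\<close>.\<close>
    then have "\<tau> (\<sigma> t) = image_series t \<sigma> oo \<tau> t"
      using fps_Aut_compose[OF Aut[OF that(2)] t0] by metis
    then show ?thesis
      using fps_compose_assoc[OF fps_inv_nth_0 \<tau>t] by (simp add: image_series_def)
  qed

  show ?thesis
    using key unique comp Phi p_integral_binom_coeff[OF p pm] binom_root_power[OF p pm]
      binom_root_nth_0[OF p] subgroup.m_closed[OF G(1)] char(2)
    by (auto simp: p_integral_def inj_on_def)
qed

end
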